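(* Let $\alpha>1$, $a>0$, and let $(\lambda_k)_{k\ge1}$ be a sequence of positive real numbers. Assume that $\gamma>0$ and $\Gamma_1<+\infty$, where $$\gamma=\inf_{k\ne n}|\lambda_k-\lambda_n|,\qquad \Gamma_1=\sup_{k\ge1}\frac{|\lambda_k-ak^\alpha|}{k^{\alpha-1}}.$$ Let $m>0$, $0<T<m$ and $u\in L^1(0,T)$. Define, for $z\in\mathbb C$, $$\mathcal G(z)=\int_0^T u(t)e^{-izt}\,dt.$$ Assume that $\mathcal G(i\lambda_1)=1$ and $\mathcal G(i\lambda_k)=0$ for all $k\ge2$. Then $$\|u\|_{L^1(0,T)}\ge c\,T^{C}e^{\frac{\rho}{T^\tau}}\quad\text{with }\tau=\frac1{\alpha-1},$$ for some positive constants $c,C$ depending only on $a,\alpha,\gamma,\Gamma_1$, and $m$, where $$\rho=2^{\frac1\beta}\,\beta\left(\frac{\kappa_\alpha}{a^{1/\alpha}(1+\beta)}\right)^{1+\frac1\beta}\quad\text{with }\beta=\alpha-1.$$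
   Context: The function $u$ is complex-valued. For $\alpha>1$, $$\kappa_\alpha=-\int_0^\infty\ln\left(\frac{x^\alpha}{x^\alpha+1}\right)dx=\frac{\pi}{\sin(\pi/\alpha)}.$$ *)

theory Defs
  imports "HOL-Analysis.Analysis"
begin

text \<open>Sequences \<open>(\<lambda>\<^sub>k)\<close>, \<open>k \<ge> 1\<close>, are functions \<open>lam :: nat \<Rightarrow> real\<close> whose value at \<open>0\<close> is
  never used.\<close>

definition seq_gap :: "(nat \<Rightarrow> real) \<Rightarrow> real" where
  "seq_gap lam = Inf {\<bar>lam k - lam n\<bar> | k n. 1 \<le> k \<and> 1 \<le> n \<and> k \<noteq> n}"

text \<open>The supremum is taken in the extended reals, since it may be infinite.\<close>

definition seq_dev :: "real \<Rightarrow> real \<Rightarrow> (nat \<Rightarrow> real) \<Rightarrow> ereal" where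
  "seq_dev a \<alpha> lam =
     (SUP k\<in>{1..}. ereal (\<bar>lam k - a * real k powr \<alpha>\<bar> / real k powr (\<alpha> - 1)))"

definition kappa :: "real \<Rightarrow> real" where
  "kappa \<alpha> = - (LINT x:{0<..}|lebesgue. ln (x powr \<alpha> / (x powr \<alpha> + 1)))"

definition rho :: "real \<Rightarrow> real \<Rightarrow> real" where
  "rho a \<alpha> = (let \<beta> = \<alpha> - 1 in
     2 powr (1 / \<beta>) * \<beta> * (kappa \<alpha> / (a powr (1 / \<alpha>) * (1 + \<beta>))) powr (1 + 1 / \<beta>))"

definition G_transform :: "real \<Rightarrow> (real \<Rightarrow> complex) \<Rightarrow> complex \<Rightarrow> complex" where
  "G_transform T u z = (LINT t:{0<..<T}|lebesgue. u t * exp (- \<i> * z * complex_of_real t))"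

definition L1_norm :: "real \<Rightarrow> (real \<Rightarrow> complex) \<Rightarrow> real" where
  "L1_norm T u = (LINT t:{0<..<T}|lebesgue. norm (u t))"

end

theory Submission
  imports Defs "HOL-Complex_Analysis.Complex_Analysis" "HOL-Real_Asymp.Real_Asymp"
begin

text \<open>For \<open>x \<ge> 0\<close> the entire function \<open>w \<mapsto> exp (- w * T) * G(\<i> * w)\<close> is bounded by
  \<open>exp (T * x / 2) * \<parallel>u\<parallel>\<close> on the half-plane \<open>Re w \<ge> - x / 2\<close>, has modulus \<open>exp (- lam 1 * T)\<close> at
  \<open>lam 1\<close>, and vanishes at the other \<open>lam k\<close>. Dividing by the Blaschke factors of the zeros in this
  half-plane and evaluating at \<open>lam 1\<close> gives
  \<open>\<Prod>k\<ge>2. (1 + x / (lam 1 + lam k)) \<le> exp (T * x / 2 + lam 1 * T) * \<parallel>u\<parallel>\<close>.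
  Since \<open>lam 1 + lam k \<le> a * (k + s) powr \<alpha>\<close> for a fixed shift \<open>s\<close>, comparing the logarithm of the
  product with \<open>\<integral> ln (1 + x / (a * t powr \<alpha>)) dt = (x / a) powr (1 / \<alpha>) * kappa \<alpha>\<close> costs only
  \<open>O(ln (1 + x))\<close>, hence a power of \<open>T\<close>. The constant \<open>rho a \<alpha>\<close> comes from the optimal choice
  of \<open>x\<close>.\<close>

section \<open>Division by Blaschke factors\<close>

text \<open>The factor \<open>(z - p) / (z + cnj p)\<close> has modulus 1 on the imaginary axis and
  tends to 1 at infinity, so dividing by it preserves the bound \<open>M\<close> on the axis and
  asymptotically on large semicircles. The maximum modulus principle carries the bound
  inside.\<close>

lemma holomorphic_halfplane_divide_Blaschke_factor:
  fixes f :: "complex \<Rightarrow> complex"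
  assumes hol: "f holomorphic_on UNIV"
    and bound: "\<And>z. Re z \<ge> 0 \<Longrightarrow> norm (f z) \<le> M"
    and p: "Re p > 0" "f p = 0"
  obtains q where "q holomorphic_on UNIV" "\<And>z. Re z \<ge> 0 \<Longrightarrow> norm (q z) \<le> M"
    "\<And>z. f z * (z + cnj p) = (z - p) * q z"
proof -
  \<comment> \<open>The difference quotient with its removable singularity filled in. Multiplying it
    by \<open>z + cnj p\<close> gives the quotient by the Blaschke factor as an entire
    function.\<close>
  define g where "g z = (if z = p then deriv f p else (f z - f p) / (z - p))" for z
  have g_hol: "g holomorphic_on UNIV"
    unfolding g_def by (rule pole_lemma[OF hol]) simp
  have fg: "f z = (z - p) * g z" for z
    using p by (simp add: g_def)
  define q where "q z = g z * (z + cnj p)" for z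
  have q_hol: "q holomorphic_on UNIV"
    unfolding q_def by (intro holomorphic_intros g_hol)
  have fq: "f z * (z + cnj p) = (z - p) * q z" for z
    by (simp add: fg q_def)
  have M0: "M \<ge> 0"
    using order_trans[OF norm_ge_zero bound[of 0]] by simp
  \<comment> \<open>Maximum modulus on the half-disc of radius \<open>R\<close>. The fraction bounds
    \<open>norm (w + cnj p) / norm (w - p)\<close> on the circle \<open>norm w = R\<close>.\<close>
  have large: "norm (q z) \<le> M * ((R + norm p) / (R - norm p))"
    if R: "R > norm p" "R > norm z" and z: "Re z \<ge> 0" for R z
  proof -
    let ?S = "{w. 0 < Re w} \<inter> ball 0 R"
    let ?B = "M * ((R + norm p) / (R - norm p))"
    have MB: "M \<le> ?B"
    proof -
      have "1 \<le> (R + norm p) / (R - norm p)"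
        using R by (simp add: field_simps)
      then have "M * 1 \<le> ?B"
        by (rule mult_left_mono) (rule M0)
      then show ?thesis by simp
    qed
    have axis: "norm (q w) \<le> ?B" if w: "Re w = 0" for w
    proof -
      \<comment> \<open>The zero \<open>p\<close> and its mirror image \<open>- cnj p\<close> are
        equidistant from every point of the imaginary axis.\<close>
      have "w + cnj p = - cnj (w - p)"
        using w by (simp add: complex_eq_iff)
      then have eq: "norm (w + cnj p) = norm (w - p)"
        by (metis complex_mod_cnj norm_minus_cancel)
      have "norm (f w) * norm (w + cnj p) = norm (w - p) * norm (q w)"
        using arg_cong[OF fq[of w], of norm] by (simp add: norm_mult)
      moreover have "w \<noteq> p" using w p by auto
      ultimately have "norm (q w) = norm (f w)"
        using eq by simp
      also have "\<dots> \<le> M" using bound w by simp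
      finally show ?thesis using MB by simp
    qed
    have circle: "norm (q w) \<le> ?B" if w: "norm w = R" "Re w \<ge> 0" for w
    proof -
      have l: "norm (w - p) \<ge> R - norm p"
        using norm_triangle_ineq2[of w p] w by simp
      have u: "norm (w + cnj p) \<le> R + norm p"
        using norm_triangle_ineq[of w "cnj p"] w by simp
      have "norm (q w) * (R - norm p) \<le> norm (q w) * norm (w - p)"
        by (rule mult_left_mono[OF l]) simp
      also have "\<dots> = norm (f w) * norm (w + cnj p)"
        using arg_cong[OF fq[of w], of norm] by (simp add: norm_mult)
      also have "\<dots> \<le> M * (R + norm p)"
        using u bound[OF w(2)] M0 by (intro mult_mono) auto
      finally show ?thesis using R by (simp add: field_simps)
    qed
    have front: "norm (q w) \<le> ?B" if w: "w \<in> frontier ?S" for w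
    proof -
      have "w \<in> closure ?S" "w \<notin> interior ?S"
        using w by (auto simp: frontier_def)
      moreover have "open ?S"
        by (intro open_Int open_halfspace_Re_gt open_ball)
      ultimately have w': "w \<in> closure ?S" "w \<notin> ?S"
        by (auto simp del: interior_Int simp: interior_open)
      have "closure ?S \<subseteq> {w. 0 \<le> Re w} \<inter> cball 0 R"
        by (rule closure_minimal) (auto intro!: closed_Int closed_halfspace_Re_ge)
      then have "0 \<le> Re w" "norm w \<le> R" using w'(1) by auto
      with w'(2) consider "Re w = 0" | "norm w = R" "Re w \<ge> 0"
        by fastforce
      then show ?thesis by cases (use axis circle in auto)
    qed
    show ?thesis
    proof (cases "Re z = 0")
      case True
      then show ?thesis by (rule axis)
    next
      case False
      have "norm (q z) \<le> ?B"
      proof (rule maximum_modulus_frontier[of q ?S])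
        show "q holomorphic_on interior ?S"
          using q_hol by (rule holomorphic_on_subset) simp
        show "continuous_on (closure ?S) q"
          using q_hol by (meson continuous_on_subset holomorphic_on_imp_continuous_on subset_UNIV)
        show "bounded ?S" by (rule bounded_Int) simp
        show "z \<in> ?S" using False z R by auto
      qed (use front in auto)
      then show ?thesis .
    qed
  qed
  have "norm (q z) \<le> M" if z: "Re z \<ge> 0" for z
  proof -
    \<comment> \<open>The point \<open>z\<close> stays fixed while the half-disc grows, so the extra
      factor tends to 1.\<close>
    have "((\<lambda>R. M * ((R + norm p) / (R - norm p))) \<longlongrightarrow> M * 1) at_top"
      by (intro tendsto_intros) real_asymp
    moreover have "\<forall>\<^sub>F R in at_top. norm (q z) \<le> M * ((R + norm p) / (R - norm p))"
      using eventually_gt_at_top[of "norm p"] eventually_gt_at_top[of "norm z"]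
      by eventually_elim (use large z in auto)
    ultimately show ?thesis
      by (metis mult.right_neutral tendsto_lowerbound trivial_limit_at_top_linorder)
  qed
  with q_hol fq that show ?thesis by blast
qed

lemma holomorphic_halfplane_Blaschke_bound:
  fixes f :: "complex \<Rightarrow> complex"
  assumes "finite P" "f holomorphic_on UNIV"
    and "\<And>z. Re z \<ge> 0 \<Longrightarrow> norm (f z) \<le> M"
    and "\<And>p. p \<in> P \<Longrightarrow> Re p > 0 \<and> f p = 0" "Re z \<ge> 0"
  shows "norm (f z) * (\<Prod>p\<in>P. norm (z + cnj p)) \<le> M * (\<Prod>p\<in>P. norm (z - p))"
  using assms
proof (induction P arbitrary: f rule: finite_induct)
  case empty
  then show ?case by simp
next
  case (insert p P)
  obtain q where q: "q holomorphic_on UNIV" "\<And>z. Re z \<ge> 0 \<Longrightarrow> norm (q z) \<le> M"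
      "\<And>z. f z * (z + cnj p) = (z - p) * q z"
    using holomorphic_halfplane_divide_Blaschke_factor[OF insert.prems(1,2)] insert.prems(3)[of p]
    by (metis insertI1)
  \<comment> \<open>\<open>P\<close> is a set, so \<open>p'\<close> differs from \<open>p\<close>;
    the zero of \<open>f\<close> at \<open>p'\<close> therefore survives the division by
    \<open>z - p\<close>.\<close>
  have "Re p' > 0 \<and> q p' = 0" if "p' \<in> P" for p'
    using that insert.prems(3)[of p'] q(3)[of p'] insert.hyps(2) by auto
  then have IH: "norm (q z) * (\<Prod>p\<in>P. norm (z + cnj p)) \<le> M * (\<Prod>p\<in>P. norm (z - p))"
    using insert.IH[OF q(1,2)] insert.prems(4) by blast
  have "norm (f z) * (\<Prod>p\<in>insert p P. norm (z + cnj p))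
      = norm (f z * (z + cnj p)) * (\<Prod>p\<in>P. norm (z + cnj p))"
    using insert.hyps by (simp add: norm_mult)
  also have "\<dots> = norm (z - p) * (norm (q z) * (\<Prod>p\<in>P. norm (z + cnj p)))"
    by (simp add: q(3) norm_mult)
  also have "\<dots> \<le> norm (z - p) * (M * (\<Prod>p\<in>P. norm (z - p)))"
    by (rule mult_left_mono[OF IH]) simp
  finally show ?case using insert.hyps by (simp add: algebra_simps)
qed

section \<open>The transform of an integrable function\<close>

text \<open>Expanding the exponential and integrating term by term gives a power series about 0 that
  converges at every \<open>z\<close>. Bounded support in \<open>t\<close> is what makes the
  interchange work.\<close>

lemma G_transform_holomorphic:
  assumes "u absolutely_integrable_on {0<..<T}"
  shows "G_transform T u holomorphic_on UNIV"
proof -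
  let ?I = "indicator {0<..<T} :: real \<Rightarrow> real"
  have u: "integrable lebesgue (\<lambda>t. ?I t *\<^sub>R u t)"
    using assms by (simp add: set_integrable_def)
  have m: "(\<lambda>t. ?I t *\<^sub>R u t) \<in> borel_measurable lebesgue"
    using u by (rule borel_measurable_integrable)
  have cont: "g \<in> borel_measurable lebesgue" if "continuous_on UNIV g" for g :: "real \<Rightarrow> complex"
    using borel_measurable_continuous_onI[OF that] by (simp add: measurable_completion)
  define c where "c n = (\<integral>t. (?I t *\<^sub>R u t) * ((- \<i> * complex_of_real t) ^ n / fact n) \<partial>lebesgue)" for n
  have "(\<lambda>n. c n * (z - 0) ^ n) sums G_transform T u z" for z
  proof -
    \<comment> \<open>A bound uniform in \<open>N\<close> and \<open>t\<close>: multiplied by the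
      norm of \<open>u\<close>, it is the integrable majorant for dominated convergence.\<close>
    have part_le: "norm (\<Sum>n<N. (- \<i> * z * complex_of_real t) ^ n / fact n) \<le> exp (norm z * T)"
      if t: "t \<in> {0<..<T}" for N t
    proof -
      have "norm (\<Sum>n<N. (- \<i> * z * complex_of_real t) ^ n / fact n)
          \<le> (\<Sum>n<N. (norm z * t) ^ n / fact n)"
        by (rule order_trans[OF norm_sum])
          (use t in \<open>simp add: norm_divide norm_power norm_mult\<close>)
      also have "\<dots> \<le> exp (norm z * t)"
        unfolding exp_def using t summable_exp_generic[of "norm z * t"]
        by (auto simp: scaleR_conv_of_real divide_inverse mult.commute
            intro!: sum_le_suminf)
      also have "\<dots> \<le> exp (norm z * T)"
        using t by (simp add: mult_left_mono)
      finally show ?thesis .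
    qed
    have bnd: "norm ((?I t *\<^sub>R u t) * (\<Sum>n<N. (- \<i> * z * complex_of_real t) ^ n / fact n))
        \<le> norm (?I t *\<^sub>R u t) * exp (norm z * T)" for N t
      unfolding norm_mult using part_le[of t N]
      by (cases "t \<in> {0<..<T}") (auto simp: indicator_def intro!: mult_left_mono)
    have int1: "integrable lebesgue
        (\<lambda>t. (?I t *\<^sub>R u t) * ((- \<i> * complex_of_real t) ^ n / fact n))" for n
    proof (rule Bochner_Integration.integrable_bound)
      show "integrable lebesgue (\<lambda>t. norm (?I t *\<^sub>R u t) * (T ^ n / fact n))"
        by (intro integrable_mult_left integrable_norm u)
      show "(\<lambda>t. (?I t *\<^sub>R u t) * ((- \<i> * complex_of_real t) ^ n / fact n))
          \<in> borel_measurable lebesgue"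
        by (intro borel_measurable_times m cont continuous_intros) auto
      have "norm ((?I t *\<^sub>R u t) * ((- \<i> * complex_of_real t) ^ n / fact n))
          \<le> norm (norm (?I t *\<^sub>R u t) * (T ^ n / fact n))" for t
        by (cases "t \<in> {0<..<T}")
          (auto simp: norm_mult norm_divide norm_power indicator_def
            intro!: mult_left_mono divide_right_mono power_mono)
      then show "AE t in lebesgue. norm ((?I t *\<^sub>R u t) * ((- \<i> * complex_of_real t) ^ n / fact n))
          \<le> norm (norm (?I t *\<^sub>R u t) * (T ^ n / fact n))" by simp
    qed
    have pow: "(- \<i> * z * complex_of_real t) ^ n = (- \<i> * complex_of_real t) ^ n * z ^ n" for t n
      by (simp only: power_mult_distrib mult_ac)
    have summand: "v * ((- \<i> * complex_of_real t) ^ n / fact n) * z ^ n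
        = v * ((- \<i> * z * complex_of_real t) ^ n / fact n)" for v t n
      unfolding pow by simp
    have partial: "(\<Sum>n<N. c n * (z - 0) ^ n)
        = (\<integral>t. (?I t *\<^sub>R u t) * (\<Sum>n<N. (- \<i> * z * complex_of_real t) ^ n / fact n) \<partial>lebesgue)" for N
    proof -
      have "(\<Sum>n<N. c n * (z - 0) ^ n)
          = (\<Sum>n<N. \<integral>t. (?I t *\<^sub>R u t) * ((- \<i> * complex_of_real t) ^ n / fact n) * z ^ n \<partial>lebesgue)"
        by (simp only: c_def diff_zero integral_mult_left_zero)
      also have "\<dots> = (\<integral>t. (\<Sum>n<N. (?I t *\<^sub>R u t) * ((- \<i> * complex_of_real t) ^ n / fact n) * z ^ n)
          \<partial>lebesgue)"
        by (rule Bochner_Integration.integral_sum[symmetric])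
          (intro integrable_mult_left int1)
      finally show ?thesis
        by (simp only: summand sum_distrib_left)
    qed
    have "(\<lambda>N. \<integral>t. (?I t *\<^sub>R u t) * (\<Sum>n<N. (- \<i> * z * complex_of_real t) ^ n / fact n) \<partial>lebesgue)
        \<longlonglongrightarrow> (\<integral>t. (?I t *\<^sub>R u t) * exp (- \<i> * z * complex_of_real t) \<partial>lebesgue)"
    proof (rule integral_dominated_convergence)
      show "integrable lebesgue (\<lambda>t. norm (?I t *\<^sub>R u t) * exp (norm z * T))"
        by (intro integrable_mult_left integrable_norm u)
      show "AE t in lebesgue. (\<lambda>N. (?I t *\<^sub>R u t) * (\<Sum>n<N. (- \<i> * z * complex_of_real t) ^ n / fact n))
          \<longlonglongrightarrow> (?I t *\<^sub>R u t) * exp (- \<i> * z * complex_of_real t)"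
      proof (intro AE_I2 tendsto_mult tendsto_const)
        fix t
        show "(\<lambda>N. \<Sum>n<N. (- \<i> * z * complex_of_real t) ^ n / fact n)
            \<longlonglongrightarrow> exp (- \<i> * z * complex_of_real t)"
          using exp_converges[of "- \<i> * z * complex_of_real t"]
          by (simp add: sums_def scaleR_conv_of_real divide_inverse mult.commute)
      qed
      show "(\<lambda>t. (?I t *\<^sub>R u t) * exp (- \<i> * z * complex_of_real t)) \<in> borel_measurable lebesgue"
        by (intro borel_measurable_times m cont continuous_intros)
      show "(\<lambda>t. (?I t *\<^sub>R u t) * (\<Sum>n<N. (- \<i> * z * complex_of_real t) ^ n / fact n))
          \<in> borel_measurable lebesgue" for N
        by (intro borel_measurable_times m cont continuous_intros) auto
      show "AE t in lebesgue. norm ((?I t *\<^sub>R u t) * (\<Sum>n<N. (- \<i> * z * complex_of_real t) ^ n / fact n))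
        \<le> norm (?I t *\<^sub>R u t) * exp (norm z * T)" for N
        using bnd by simp
    qed
    then show ?thesis
      unfolding sums_def partial by (simp add: G_transform_def set_lebesgue_integral_def)
  qed
  then have "G_transform T u holomorphic_on ball 0 r" for r
    by (rule power_series_holomorphic)
  then have "G_transform T u field_differentiable at z" for z
    using holomorphic_on_imp_differentiable_at[of _ "ball 0 (norm z + 1)" z] by simp
  then show ?thesis
    by (simp add: holomorphic_on_def)
qed

text \<open>The two exponentials combine to \<open>exp (- w * (T - t))\<close> with
  \<open>T - t\<close> between 0 and \<open>T\<close>. The prefactor thus turns growth to the right
  into decay, and only a negative real part of \<open>w\<close>, at worst \<open>- y\<close>, costs
  anything.\<close>

lemma norm_exp_times_G_transform_le:
  assumes u: "u absolutely_integrable_on {0<..<T}" and "0 < T" "0 \<le> y" and w: "Re w \<ge> - y"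
  shows "norm (exp (- w * T) * G_transform T u (\<i> * w)) \<le> exp (T * y) * L1_norm T u"
proof -
  let ?I = "indicator {0<..<T} :: real \<Rightarrow> real"
  have int: "integrable lebesgue (\<lambda>t. ?I t *\<^sub>R u t)"
    using u by (simp add: set_integrable_def)
  have "exp (- w * T) * G_transform T u (\<i> * w)
      = (\<integral>t. exp (- w * T) * (?I t *\<^sub>R (u t * exp (w * complex_of_real t))) \<partial>lebesgue)"
    by (simp only: G_transform_def set_lebesgue_integral_def integral_mult_right_zero) (simp add: mult.assoc[symmetric])
  also have "norm \<dots>
      \<le> (\<integral>t. norm (exp (- w * T) * (?I t *\<^sub>R (u t * exp (w * complex_of_real t)))) \<partial>lebesgue)"
    by (rule integral_norm_bound)
  also have "\<dots> \<le> (\<integral>t. exp (T * y) * norm (?I t *\<^sub>R u t) \<partial>lebesgue)"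
  proof (rule integral_mono')
    show "integrable lebesgue (\<lambda>t. exp (T * y) * norm (?I t *\<^sub>R u t))"
      by (intro integrable_mult_right integrable_norm int)
    show "norm (exp (- w * T) * (?I t *\<^sub>R (u t * exp (w * complex_of_real t))))
        \<le> exp (T * y) * norm (?I t *\<^sub>R u t)" for t
    proof (cases "t \<in> {0<..<T}")
      case True
      have "- Re w * (T - t) \<le> y * (T - t)"
        by (rule mult_right_mono) (use w True in auto)
      also have "\<dots> \<le> y * T"
        using True \<open>0 \<le> y\<close> by (intro mult_left_mono) auto
      finally have le: "- Re w * T + Re w * t \<le> T * y"
        by (simp add: algebra_simps)
      have "norm (exp (- w * T) * (?I t *\<^sub>R (u t * exp (w * complex_of_real t))))
          = exp (- Re w * T + Re w * t) * norm (u t)"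
        using True by (simp add: norm_mult flip: exp_add)
      also have "\<dots> \<le> exp (T * y) * norm (u t)"
        using le by (intro mult_right_mono) auto
      finally show ?thesis using True by simp
    qed simp
  qed simp
  also have "\<dots> = exp (T * y) * L1_norm T u"
    by (simp add: L1_norm_def set_lebesgue_integral_def)
  finally show ?thesis .
qed

section \<open>Comparison of a sum with \<open>kappa\<close>\<close>

text \<open>A majorant integrable near 0 that depends on \<open>\<sigma>\<close> only through a
  logarithm. For \<open>t < 1\<close> the power \<open>t powr (- \<alpha>)\<close> is pulled out of
  the logarithm, and the remaining \<open>- ln t\<close> is at most
  \<open>2 * t powr (- (1 / 2))\<close>.\<close>

lemma ln_1_plus_powr_divide_le:
  fixes \<alpha> \<sigma> t :: real
  assumes "\<alpha> > 0" "\<sigma> > 0" "t > 0"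
  shows "ln (1 + (\<sigma> / t) powr \<alpha>) \<le> ln (1 + \<sigma> powr \<alpha>) + 2 * \<alpha> * t powr (- (1 / 2))"
proof (cases "t \<ge> 1")
  case True
  have "(\<sigma> / t) powr \<alpha> \<le> \<sigma> powr \<alpha>"
    using assms True by (intro powr_mono2) (auto simp: field_simps)
  then have "ln (1 + (\<sigma> / t) powr \<alpha>) \<le> ln (1 + \<sigma> powr \<alpha>)"
    by (intro ln_mono) (auto intro: add_pos_nonneg)
  moreover have "0 \<le> 2 * \<alpha> * t powr (- (1 / 2))"
    using assms by simp
  ultimately show ?thesis by linarith
next
  case False
  have pos: "1 + \<sigma> powr \<alpha> > 0" by (simp add: add_pos_nonneg)
  have "1 \<le> t powr (- \<alpha>)"
    using False assms by (simp add: powr_minus field_simps powr_le1)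
  then have "1 + (\<sigma> / t) powr \<alpha> \<le> (1 + \<sigma> powr \<alpha>) * t powr (- \<alpha>)"
    using assms by (simp add: powr_divide powr_minus field_simps)
  then have "ln (1 + (\<sigma> / t) powr \<alpha>) \<le> ln ((1 + \<sigma> powr \<alpha>) * t powr (- \<alpha>))"
    by (intro ln_mono) (auto intro: add_pos_nonneg)
  also have "\<dots> = ln (1 + \<sigma> powr \<alpha>) - \<alpha> * ln t"
    using assms pos by (simp add: ln_mult ln_powr)
  finally have 1: "ln (1 + (\<sigma> / t) powr \<alpha>) \<le> ln (1 + \<sigma> powr \<alpha>) - \<alpha> * ln t" .
  have "ln (t powr (- (1 / 2))) \<le> t powr (- (1 / 2))"
    using ln_le_minus_one[of "t powr (- (1 / 2))"] assms by simp
  then have "- ln t \<le> 2 * t powr (- (1 / 2))"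
    using assms by (simp add: ln_powr)
  then have "\<alpha> * (- ln t) \<le> \<alpha> * (2 * t powr (- (1 / 2)))"
    using assms by (intro mult_left_mono) auto
  with 1 show ?thesis by simp
qed

text \<open>The integrand of \<open>kappa\<close> equals
  \<open>- ln (1 + (1 / t) powr \<alpha>)\<close>; the substitution of \<open>t / \<sigma>\<close>
  for \<open>t\<close> then produces the factor \<open>\<sigma>\<close>.\<close>

lemma kappa_scaled:
  assumes "\<alpha> > 0" "\<sigma> > 0"
  shows "\<sigma> * kappa \<alpha>
    = (\<integral>t. indicator {0<..} t * ln (1 + (\<sigma> / t) powr \<alpha>) \<partial>lborel)"
proof -
  define g :: "real \<Rightarrow> real" where "g t = indicator {0<..} t * ln (1 + (1 / t) powr \<alpha>)" for t
  have [measurable]: "g \<in> borel_measurable borel"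
    unfolding g_def by measurable
  have "ln (t powr \<alpha> / (t powr \<alpha> + 1)) = - ln (1 + (1 / t) powr \<alpha>)" if "t > 0" for t
  proof -
    have "t powr \<alpha> > 0" using that by simp
    then have "ln (t powr \<alpha> / (t powr \<alpha> + 1)) = ln (inverse (1 + (1 / t) powr \<alpha>))"
      using that by (intro arg_cong[of _ _ ln]) (simp add: powr_divide field_simps)
    then show ?thesis by (simp only: ln_inverse)
  qed
  then have "indicator {0<..} t *\<^sub>R ln (t powr \<alpha> / (t powr \<alpha> + 1)) = - g t" for t
    by (cases "t > 0") (auto simp: g_def)
  then have "kappa \<alpha> = (\<integral>t. g t \<partial>lebesgue)"
    by (simp add: kappa_def set_lebesgue_integral_def)
  also have "\<dots> = (\<integral>t. g t \<partial>lborel)"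
    by (rule integral_completion) simp
  also have "\<dots> = (1 / \<sigma>) * (\<integral>t. g (0 + (1 / \<sigma>) * t) \<partial>lborel)"
   using assms lborel_integral_real_affine[of "1 / \<sigma>" g 0] by simp
  also have "(\<lambda>t. g (0 + (1 / \<sigma>) * t)) = (\<lambda>t. indicator {0<..} t * ln (1 + (\<sigma> / t) powr \<alpha>))"
    using assms by (auto simp: g_def indicator_def zero_less_divide_iff)
  finally show ?thesis using assms by simp
qed

lemma kappa_nonneg: "\<alpha> > 0 \<Longrightarrow> kappa \<alpha> \<ge> 0"
  using kappa_scaled[of \<alpha> 1]
  by (auto intro!: integral_nonneg_AE ln_ge_zero simp: indicator_def)

text \<open>The integral representing \<open>\<sigma> * kappa \<alpha>\<close> is split at
  \<open>S\<close>. Up to \<open>S\<close> the integrable majorant is used; beyond it the integrand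
  decreases, so the piece over \<open>(j, j + 1]\<close> is at most its value at
  \<open>j\<close>.\<close>

lemma kappa_scaled_le_sum:
  fixes \<alpha> \<sigma> B :: real and S :: nat
  assumes \<alpha>: "\<alpha> > 0" and \<sigma>: "\<sigma> > 0" and S: "S \<ge> 1"
    and B: "\<And>N. (\<Sum>j=S..<S+N. ln (1 + (\<sigma> / real j) powr \<alpha>)) \<le> B"
  shows "\<sigma> * kappa \<alpha> \<le> S * ln (1 + \<sigma> powr \<alpha>) + 4 * \<alpha> * sqrt S + B"
proof -
  define h where "h t = ln (1 + (\<sigma> / t) powr \<alpha>)" for t :: real
  have [measurable]: "h \<in> borel_measurable borel"
    unfolding h_def by measurable
  have h0: "h t \<ge> 0" for t
    unfolding h_def by (intro ln_ge_zero) simp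
  have B0: "B \<ge> 0" using B[of 0] by simp
  define A where "A = S * ln (1 + \<sigma> powr \<alpha>) + 4 * \<alpha> * sqrt S"
  have A0: "A \<ge> 0" using \<alpha> by (simp add: A_def)
  \<comment> \<open>\<open>A\<close> is the exact integral of the majorant over
    \<open>[0, S]\<close>; the square root comes from integrating
    \<open>t powr (- (1 / 2))\<close>.\<close>
  have start: "(\<integral>\<^sup>+t\<in>{0<..real S}. ennreal (h t) \<partial>lborel) \<le> ennreal A"
  proof -
    let ?b = "\<lambda>t. ln (1 + \<sigma> powr \<alpha>) + 2 * \<alpha> * t powr (- (1 / 2))"
    have "((\<lambda>t. t powr (- (1 / 2))) has_integral (real S powr (- (1 / 2) + 1) / (- (1 / 2) + 1))) {0..real S}"
      by (rule has_integral_powr_from_0) auto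
    then have "((\<lambda>t. t powr (- (1 / 2))) has_integral (2 * sqrt S)) {0..real S}"
      by (simp add: powr_half_sqrt mult.commute)
    from has_integral_add[OF has_integral_const_real[of "ln (1 + \<sigma> powr \<alpha>)" 0 "real S"]
        has_integral_mult_right[OF this, of "2 * \<alpha>"]]
    have I: "(?b has_integral A) {0..real S}"
      by (simp add: A_def mult_ac)
    have "(\<integral>\<^sup>+t\<in>{0<..real S}. ennreal (h t) \<partial>lborel)
        \<le> (\<integral>\<^sup>+t\<in>{0..real S}. ennreal (?b t) \<partial>lborel)"
      unfolding h_def using \<alpha> \<sigma>
      by (intro nn_integral_mono)
        (auto simp: indicator_def simp del: ennreal_plus
          intro!: ennreal_leI ln_1_plus_powr_divide_le[of \<alpha> \<sigma>])
    also have "\<dots> = ennreal A"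
      using \<alpha> by (intro nn_integral_has_integral_lebesgue'[OF _ I]) auto
    finally show ?thesis .
  qed
  have part: "(\<integral>\<^sup>+t\<in>{0<..real (S + N)}. ennreal (h t) \<partial>lborel)
      \<le> ennreal (A + (\<Sum>j=S..<S+N. h (real j)))" for N
  proof (induction N)
    case 0
    then show ?case using start by simp
  next
    case (Suc N)
    let ?s = "real (S + N)"
    have split: "{0<..real (S + Suc N)} = {0<..?s} \<union> {?s<..?s + 1}"
      by auto
    have "(\<integral>\<^sup>+t\<in>{0<..real (S + Suc N)}. ennreal (h t) \<partial>lborel)
      = (\<integral>\<^sup>+t\<in>{0<..?s}. ennreal (h t) \<partial>lborel) + (\<integral>\<^sup>+t\<in>{?s<..?s + 1}. ennreal (h t) \<partial>lborel)"
      unfolding split by (rule nn_integral_disjoint_pair) auto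
    also have "(\<integral>\<^sup>+t\<in>{?s<..?s + 1}. ennreal (h t) \<partial>lborel)
        \<le> (\<integral>\<^sup>+t\<in>{?s<..?s + 1}. ennreal (h ?s) \<partial>lborel)"
    proof (intro nn_integral_mono)
      fix t
      have "h t \<le> h ?s" if "t > ?s"
      proof -
        have "(\<sigma> / t) powr \<alpha> \<le> (\<sigma> / ?s) powr \<alpha>"
          using that S \<alpha> \<sigma> by (intro powr_mono2 divide_left_mono) auto
        then show ?thesis
          unfolding h_def by (intro ln_mono) (auto intro: add_pos_nonneg)
      qed
      then show "ennreal (h t) * indicator {?s<..?s + 1} t
          \<le> ennreal (h ?s) * indicator {?s<..?s + 1} t"
        by (auto simp: indicator_def intro!: ennreal_leI)
    qed
    also have "\<dots> = ennreal (h ?s)"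
      by (subst nn_integral_cmult_indicator) auto
    also have "(\<integral>\<^sup>+t\<in>{0<..?s}. ennreal (h t) \<partial>lborel) + ennreal (h ?s)
        \<le> ennreal (A + (\<Sum>j=S..<S+N. h (real j))) + ennreal (h ?s)"
      by (intro add_right_mono Suc.IH)
    also have "\<dots> = ennreal (A + (\<Sum>j=S..<S+Suc N. h (real j)))"
      using A0 h0 by (simp add: sum_nonneg add.assoc flip: ennreal_plus)
    finally show ?case by (simp add: add_left_mono)
  qed
  \<comment> \<open>Monotone convergence for nonnegative integrals; finiteness of the full integral
    comes out of the uniform bound \<open>A + B\<close> instead of being assumed.\<close>
  have "(\<lambda>N. \<integral>\<^sup>+t\<in>{0<..real (S + N)}. ennreal (h t) \<partial>lborel)
      \<longlonglongrightarrow> (\<integral>\<^sup>+t\<in>{0<..}. ennreal (h t) \<partial>lborel)"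
  proof (rule nn_integral_LIMSEQ)
    show "incseq (\<lambda>N t. ennreal (h t) * indicator {0<..real (S + N)} t)"
      by (auto simp: incseq_def le_fun_def indicator_def)
    fix t
    have "\<forall>\<^sub>F N in sequentially. t \<le> real (S + N)"
      using eventually_ge_at_top[of "nat \<lceil>t\<rceil>"] by eventually_elim linarith
    then have "\<forall>\<^sub>F N in sequentially.
        ennreal (h t) * indicator {0<..real (S + N)} t = ennreal (h t) * indicator {0<..} t"
      by eventually_elim (auto simp: indicator_def)
    then show "(\<lambda>N. ennreal (h t) * indicator {0<..real (S + N)} t)
        \<longlonglongrightarrow> ennreal (h t) * indicator {0<..} t"
      by (rule tendsto_eventually)
  qed auto
  moreover have "(\<integral>\<^sup>+t\<in>{0<..real (S + N)}. ennreal (h t) \<partial>lborel) \<le> ennreal (A + B)" for N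
    using B[of N] by (intro order_trans[OF part]) (auto simp: h_def intro!: ennreal_leI)
  ultimately have "(\<integral>\<^sup>+t\<in>{0<..}. ennreal (h t) \<partial>lborel) \<le> ennreal (A + B)"
    by (meson LIMSEQ_le_const2)
  also have "(\<integral>\<^sup>+t\<in>{0<..}. ennreal (h t) \<partial>lborel)
      = (\<integral>\<^sup>+t. ennreal (indicator {0<..} t * h t) \<partial>lborel)"
    by (intro nn_integral_cong) (auto simp: indicator_def)
  finally have "(\<integral>t. indicator {0<..} t * h t \<partial>lborel) \<le> A + B"
    using A0 B0 by (intro integral_real_bounded) auto
  then show ?thesis
    using kappa_scaled[OF \<alpha> \<sigma>] by (simp add: h_def A_def)
qed

section \<open>The lower bound\<close>

text \<open>Translation by \<open>x / 2\<close> moves the half-plane to \<open>Re z \<ge> 0\<close>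
  and the zeros to \<open>lam k + x / 2\<close>. In the Blaschke factors at the translate of
  \<open>lam 1\<close>, the shifts add up to \<open>x\<close> in \<open>z + cnj p\<close> and cancel
  in \<open>z - p\<close>.\<close>

lemma prod_le_exp_times_L1_norm:
  fixes lam :: "nat \<Rightarrow> real"
  assumes u: "u absolutely_integrable_on {0<..<T}" and T: "0 < T" and x: "0 \<le> x"
    and pos: "\<And>k. k \<ge> 1 \<Longrightarrow> lam k > 0" and inj: "inj_on lam {1..}"
    and G1: "G_transform T u (\<i> * complex_of_real (lam 1)) = 1"
    and G0: "\<And>k. k \<ge> 2 \<Longrightarrow> G_transform T u (\<i> * complex_of_real (lam k)) = 0"
  shows "(\<Prod>k=2..<N. 1 + x / (lam 1 + lam k)) \<le> exp (T * x / 2 + lam 1 * T) * L1_norm T u"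
proof -
  define y where "y = x / 2"
  have y: "y \<ge> 0" using x by (simp add: y_def)
  define f where
    "f z = exp (- (z - complex_of_real y) * T) * G_transform T u (\<i> * (z - complex_of_real y))" for z
  let ?p = "\<lambda>k. complex_of_real (lam k + y)"
  let ?P = "?p ` {2..<N}"
  have hol: "f holomorphic_on UNIV"
  proof -
    have "(G_transform T u \<circ> (\<lambda>z. \<i> * (z - complex_of_real y))) holomorphic_on UNIV"
      by (rule holomorphic_on_compose_gen[OF _ G_transform_holomorphic[OF u]])
        (auto intro!: holomorphic_intros)
    then show ?thesis
      unfolding f_def o_def by (intro holomorphic_intros)
  qed
  have bound: "norm (f z) \<le> exp (T * y) * L1_norm T u" if "Re z \<ge> 0" for z
    unfolding f_def using that by (intro norm_exp_times_G_transform_le u T y) simp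
  have zeros: "Re p > 0 \<and> f p = 0" if "p \<in> ?P" for p
    using that y pos G0 by (auto simp: f_def intro!: add_pos_nonneg)
  have "Re (?p 1) \<ge> 0" using pos[of 1] y by simp
  from holomorphic_halfplane_Blaschke_bound[OF _ hol bound zeros this]
  have bl: "norm (f (?p 1)) * (\<Prod>p\<in>?P. norm (?p 1 + cnj p))
      \<le> exp (T * y) * L1_norm T u * (\<Prod>p\<in>?P. norm (?p 1 - p))"
    by simp
  \<comment> \<open>Distinct exponents give distinct zeros, so the product over the set of zeros is
    a product over the indices.\<close>
  have inj': "inj_on ?p {2..<N}"
    using inj by (auto simp: inj_on_def)
  have f1: "norm (f (?p 1)) = exp (- lam 1 * T)"
    using G1 by (simp add: f_def)
  have num: "norm (?p 1 + cnj (?p k)) = lam 1 + lam k + x" if "k \<in> {2..<N}" for k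
  proof -
    have eq: "?p 1 + cnj (?p k) = complex_of_real (lam 1 + lam k + x)"
      by (simp add: y_def)
    show ?thesis
      unfolding eq norm_of_real using pos[of 1] pos[of k] that x by simp
  qed
  \<comment> \<open>Replacing the difference by the larger sum \<open>lam 1 + lam k\<close> weakens
    the estimate but makes each factor \<open>1 + x / (lam 1 + lam k)\<close>.\<close>
  have den: "norm (?p 1 - ?p k) \<le> lam 1 + lam k" if "k \<in> {2..<N}" for k
  proof -
    have eq: "?p 1 - ?p k = complex_of_real (lam 1 - lam k)"
      by simp
    show ?thesis
      unfolding eq norm_of_real using pos[of 1] pos[of k] that by simp
  qed
  have L0: "L1_norm T u \<ge> 0"
    unfolding L1_norm_def set_lebesgue_integral_def by (intro integral_nonneg_AE) simp
  let ?D = "\<Prod>k=2..<N. lam 1 + lam k"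
  have D: "?D > 0"
    using pos by (intro prod_pos add_pos_pos) auto
  then have "?D \<noteq> 0" by (metis less_irrefl)
  have "exp (- lam 1 * T) * (\<Prod>k=2..<N. lam 1 + lam k + x)
      = norm (f (?p 1)) * (\<Prod>p\<in>?P. norm (?p 1 + cnj p))"
    using num by (simp only: f1 prod.reindex[OF inj'] o_def cong: prod.cong)
  also have "\<dots> \<le> exp (T * y) * L1_norm T u * (\<Prod>k=2..<N. norm (?p 1 - ?p k))"
    using bl by (simp only: prod.reindex[OF inj'] o_def)
  also have "\<dots> \<le> exp (T * y) * L1_norm T u * ?D"
    using L0 by (intro mult_left_mono prod_mono conjI norm_ge_zero den) auto
  finally have main: "exp (- lam 1 * T) * (\<Prod>k=2..<N. lam 1 + lam k + x)
      \<le> exp (T * y) * L1_norm T u * ?D" .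
  have "(\<Prod>k=2..<N. 1 + x / (lam 1 + lam k)) = (\<Prod>k=2..<N. (lam 1 + lam k + x) / (lam 1 + lam k))"
  proof (intro prod.cong refl)
    fix k assume "k \<in> {2..<N}"
    then have "lam 1 + lam k > 0" using pos[of 1] pos[of k] by simp
    then show "1 + x / (lam 1 + lam k) = (lam 1 + lam k + x) / (lam 1 + lam k)"
      by (simp add: field_simps)
  qed
  also have "\<dots> = exp (lam 1 * T) * (exp (- lam 1 * T) * (\<Prod>k=2..<N. lam 1 + lam k + x)) / ?D"
    by (simp add: prod_dividef exp_minus)
  also have "\<dots> \<le> exp (lam 1 * T) * (exp (T * y) * L1_norm T u * ?D) / ?D"
    using main D by (intro divide_right_mono mult_left_mono) auto
  also have "\<dots> = exp (T * x / 2 + lam 1 * T) * L1_norm T u"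
    by (simp only: y_def exp_add nonzero_mult_div_cancel_right[OF \<open>?D \<noteq> 0\<close>] times_divide_eq_right
        mult.assoc[symmetric]) (simp add: mult_ac)
  finally show ?thesis .
qed

text \<open>Convexity of the power function. It allows an error of order
  \<open>t powr (\<alpha> - 1)\<close> in the exponents to be absorbed by a constant shift of the
  index.\<close>

lemma powr_add_ge_tangent:
  fixes t s \<alpha> :: real
  assumes "t > 0" "s \<ge> 0" "\<alpha> \<ge> 1"
  shows "t powr \<alpha> + \<alpha> * s * t powr (\<alpha> - 1) \<le> (t + s) powr \<alpha>"
proof (cases "s = 0")
  case False
  have "\<exists>z>t. z < t + s \<and> (t + s) powr \<alpha> - t powr \<alpha> = (t + s - t) * (\<alpha> * z powr (\<alpha> - 1))"
    using assms False by (intro MVT2) (auto intro!: derivative_eq_intros)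
  then obtain z where z: "z > t" "(t + s) powr \<alpha> - t powr \<alpha> = s * (\<alpha> * z powr (\<alpha> - 1))"
    by auto
  have "t powr (\<alpha> - 1) \<le> z powr (\<alpha> - 1)"
    using assms z by (intro powr_mono2) auto
  then have "(\<alpha> * s) * t powr (\<alpha> - 1) \<le> (\<alpha> * s) * z powr (\<alpha> - 1)"
    using assms by (intro mult_left_mono) auto
  then show ?thesis using z(2) by (simp add: algebra_simps)
qed simp

lemma kappa_scaled_le_ln_L1_norm:
  fixes lam :: "nat \<Rightarrow> real" and s :: nat and a \<alpha> \<Gamma> T x :: real
  assumes u: "u absolutely_integrable_on {0<..<T}" and T: "0 < T" and x: "0 \<le> x"
    and \<alpha>: "\<alpha> > 1" and a: "a > 0" and \<Gamma>: "\<Gamma> \<ge> 0" and s: "a + 2 * \<Gamma> \<le> a * \<alpha> * s"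
    and pos: "\<And>k. k \<ge> 1 \<Longrightarrow> lam k > 0" and inj: "inj_on lam {1..}"
    and dev: "\<And>k. k \<ge> 1 \<Longrightarrow> \<bar>lam k - a * real k powr \<alpha>\<bar> \<le> \<Gamma> * real k powr (\<alpha> - 1)"
    and G1: "G_transform T u (\<i> * complex_of_real (lam 1)) = 1"
    and G0: "\<And>k. k \<ge> 2 \<Longrightarrow> G_transform T u (\<i> * complex_of_real (lam k)) = 0"
  shows "L1_norm T u > 0"
    and "(x / a) powr (1 / \<alpha>) * kappa \<alpha> \<le> (s + 2) * ln (1 + x / a) + 4 * \<alpha> * sqrt (s + 2)
      + T * x / 2 + (a + \<Gamma>) * T + ln (L1_norm T u)"
proof -
  note prod = prod_le_exp_times_L1_norm[OF u T _ pos inj G1 G0]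
  \<comment> \<open>For \<open>N = 2\<close> the product is empty, so its value 1 already forces a
    positive norm.\<close>
  have "0 < exp (T * x / 2 + lam 1 * T) * L1_norm T u"
    using prod[OF x, of 2] by simp
  then show L: "L1_norm T u > 0"
    by (simp add: zero_less_mult_iff)
  have lam1: "lam 1 \<le> a + \<Gamma>"
    using dev[of 1] by simp
  then have lam1T: "lam 1 * T \<le> (a + \<Gamma>) * T"
    using T by (intro mult_right_mono) auto
  define B where "B = T * x / 2 + (a + \<Gamma>) * T + ln (L1_norm T u)"
  have ln_prod_le: "ln (\<Prod>k=2..<N. 1 + x / (lam 1 + lam k)) \<le> B" for N
  proof -
    have "(\<Prod>k=2..<N. 1 + x / (lam 1 + lam k)) > 0"
    proof (intro prod_pos add_pos_nonneg divide_nonneg_nonneg x)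
      show "0 \<le> lam 1 + lam k" if "k \<in> {2..<N}" for k
        using pos[of 1] pos[of k] that by simp
    qed auto
    then have "ln (\<Prod>k=2..<N. 1 + x / (lam 1 + lam k)) \<le> ln (exp (T * x / 2 + lam 1 * T) * L1_norm T u)"
      using prod[OF x, of N] by (intro ln_mono)
    also have "\<dots> = T * x / 2 + lam 1 * T + ln (L1_norm T u)"
      using L by (simp add: ln_mult)
    finally show ?thesis using lam1T by (simp add: B_def)
  qed
  \<comment> \<open>For \<open>x = 0\<close> the scale \<open>\<sigma>\<close> would vanish; there
    the claim reduces to \<open>0 \<le> B\<close>, which the empty product supplies.\<close>
  have "(x / a) powr (1 / \<alpha>) * kappa \<alpha> \<le> (s + 2) * ln (1 + x / a) + 4 * \<alpha> * sqrt (s + 2) + B"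
  proof (cases "x = 0")
    case True
    then show ?thesis
      using ln_prod_le[of 2] \<alpha> by simp
  next
    case False
    with x have x: "x > 0" by simp
    define \<sigma> where "\<sigma> = (x / a) powr (1 / \<alpha>)"
    have \<sigma>: "\<sigma> > 0" "\<sigma> powr \<alpha> = x / a"
      using x a \<alpha> by (simp_all add: \<sigma>_def powr_powr)
    \<comment> \<open>Since \<open>k powr (\<alpha> - 1)\<close> is at least 1, the bound
      \<open>a + \<Gamma>\<close> on \<open>lam 1\<close> joins the deviation
      \<open>\<Gamma>\<close> of \<open>lam k\<close> in one error coefficient
      \<open>a + 2 * \<Gamma>\<close>, which the shift \<open>s\<close> dominates.\<close>
    have le: "lam 1 + lam k \<le> a * real (k + s) powr \<alpha>" if k: "k \<ge> 1" for k
    proof -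
      have one: "1 \<le> real k powr (\<alpha> - 1)"
        using k \<alpha> by (intro ge_one_powr_ge_zero) auto
      have "lam 1 \<le> (a + \<Gamma>) * real k powr (\<alpha> - 1)"
        using order_trans[OF lam1] a \<Gamma> mult_left_mono[OF one, of "a + \<Gamma>"] by simp
      moreover have "lam k \<le> a * real k powr \<alpha> + \<Gamma> * real k powr (\<alpha> - 1)"
        using dev[OF k] by simp
      ultimately have "lam 1 + lam k \<le> a * real k powr \<alpha> + (a + 2 * \<Gamma>) * real k powr (\<alpha> - 1)"
        by (simp add: algebra_simps)
      also have "\<dots> \<le> a * real k powr \<alpha> + (a * \<alpha> * s) * real k powr (\<alpha> - 1)"
        using s by (intro add_left_mono mult_right_mono) auto
      also have "\<dots> = a * (real k powr \<alpha> + \<alpha> * s * real k powr (\<alpha> - 1))"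
        by (simp add: algebra_simps)
      also have "\<dots> \<le> a * (real k + real s) powr \<alpha>"
        using k \<alpha> a by (intro mult_left_mono powr_add_ge_tangent) auto
      finally show ?thesis by simp
    qed
    have "\<sigma> * kappa \<alpha> \<le> real (s + 2) * ln (1 + \<sigma> powr \<alpha>) + 4 * \<alpha> * sqrt (real (s + 2)) + B"
    proof (rule kappa_scaled_le_sum)
      fix N
      \<comment> \<open>Substituting \<open>j = k + s\<close>: the zeros start at
        \<open>k = 2\<close>, hence the sum starts at \<open>s + 2\<close>.\<close>
      have "(\<Sum>j=s+2..<s+2+N. ln (1 + (\<sigma> / real j) powr \<alpha>))
          = (\<Sum>k=2..<2+N. ln (1 + (\<sigma> / real (k + s)) powr \<alpha>))"
        using sum.shift_bounds_nat_ivl[of "\<lambda>j. ln (1 + (\<sigma> / real j) powr \<alpha>)" 2 s "2 + N"]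
        by (simp add: add_ac)
      also have "\<dots> \<le> (\<Sum>k=2..<2+N. ln (1 + x / (lam 1 + lam k)))"
      proof (intro sum_mono ln_mono add_left_mono)
        fix k assume k: "k \<in> {2..<2+N}"
        have p: "lam 1 + lam k > 0" using pos[of 1] pos[of k] k by simp
        have "(\<sigma> / real (k + s)) powr \<alpha> = x / (a * real (k + s) powr \<alpha>)"
          using \<sigma> by (simp add: powr_divide)
        also have "\<dots> \<le> x / (lam 1 + lam k)"
          using le[of k] k x p a by (intro divide_left_mono mult_pos_pos) (auto intro: less_le_trans)
        finally show "(\<sigma> / real (k + s)) powr \<alpha> \<le> x / (lam 1 + lam k)" .
      qed (auto intro: add_pos_nonneg)
      also have "\<dots> = ln (\<Prod>k=2..<2+N. 1 + x / (lam 1 + lam k))"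
      proof (rule ln_prod[symmetric])
        fix k assume "k \<in> {2..<2+N}"
        then have "lam 1 + lam k > 0" using pos[of 1] pos[of k] by simp
        then have "0 < 1 + x / (lam 1 + lam k)" using x by (simp add: add_pos_nonneg)
        then show "1 + x / (lam 1 + lam k) \<noteq> 0" by (metis less_irrefl)
      qed simp
      finally show "(\<Sum>j=s+2..<s+2+N. ln (1 + (\<sigma> / real j) powr \<alpha>)) \<le> B"
        using ln_prod_le order_trans by blast
    qed (use \<alpha> \<sigma> in auto)
    then show ?thesis by (simp add: \<sigma> flip: \<sigma>_def)
  qed
  then show "(x / a) powr (1 / \<alpha>) * kappa \<alpha> \<le> (s + 2) * ln (1 + x / a) + 4 * \<alpha> * sqrt (s + 2)
      + T * x / 2 + (a + \<Gamma>) * T + ln (L1_norm T u)"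
    by (simp add: B_def)
qed

text \<open>The point \<open>x\<close> maximises the concave function \<open>x \<mapsto> (x / a) powr (1 / \<alpha>) * kappa \<alpha> - T * x / 2\<close>,
  and \<open>rho a \<alpha> / T powr (1 / (\<alpha> - 1))\<close> is the maximum.\<close>

lemma rho_eq_maximum:
  assumes \<alpha>: "\<alpha> > 1" and a: "a > 0" and T: "T > 0"
    and x: "x = (2 * (kappa \<alpha> / a powr (1 / \<alpha>)) / (\<alpha> * T)) powr (\<alpha> / (\<alpha> - 1))"
  shows "(x / a) powr (1 / \<alpha>) * kappa \<alpha> - T * x / 2 = rho a \<alpha> / T powr (1 / (\<alpha> - 1))"
\<comment> \<open>Only \<open>kappa \<alpha> \<ge> 0\<close> has been established. If it is 0, then
  \<open>x = 0\<close> and both sides vanish.\<close>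
proof (cases "kappa \<alpha> = 0")
  case True
  then show ?thesis by (simp add: x rho_def Let_def)
next
  case False
  define A where "A = kappa \<alpha> / a powr (1 / \<alpha>)"
  have A: "A > 0"
    using False kappa_nonneg[of \<alpha>] \<alpha> a by (simp add: A_def)
  \<comment> \<open>The critical point equation for
    \<open>A * x powr (1 / \<alpha>) - T * x / 2\<close> is
    \<open>x powr ((\<alpha> - 1) / \<alpha>) = X\<close>.\<close>
  define X where "X = 2 * A / (\<alpha> * T)"
  have X: "X > 0" using A \<alpha> T by (simp add: X_def)
  have e: "\<alpha> / (\<alpha> - 1) = 1 + 1 / (\<alpha> - 1)"
    using \<alpha> by (simp add: field_simps)
  have xX: "x = X powr (\<alpha> / (\<alpha> - 1))"
    by (simp add: x X_def A_def)
  define P where "P = X powr (1 / (\<alpha> - 1))"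
  have x1: "x = X * P"
    using X by (simp add: xX e P_def powr_add)
  have x2: "x powr (1 / \<alpha>) = P"
    using \<alpha> by (simp add: xX P_def powr_powr)
  have "(x / a) powr (1 / \<alpha>) * kappa \<alpha> - T * x / 2 = A * P - T * (X * P) / 2"
    using a X by (simp add: powr_divide x2 A_def flip: x1)
  also have "\<dots> = A * P * ((\<alpha> - 1) / \<alpha>)"
    using \<alpha> T by (simp add: X_def field_simps)
  also have "P = 2 powr (1 / (\<alpha> - 1)) * (A / \<alpha>) powr (1 / (\<alpha> - 1)) / T powr (1 / (\<alpha> - 1))"
  proof -
    have "X = 2 * (A / \<alpha>) / T" using \<alpha> T by (simp add: X_def)
    then show ?thesis
      using A \<alpha> T by (simp only: P_def powr_divide powr_mult)
  qed
  also have "A * (2 powr (1 / (\<alpha> - 1)) * (A / \<alpha>) powr (1 / (\<alpha> - 1)) / T powr (1 / (\<alpha> - 1))) * ((\<alpha> - 1) / \<alpha>)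
      = 2 powr (1 / (\<alpha> - 1)) * (\<alpha> - 1) * (A / \<alpha>) powr (1 + 1 / (\<alpha> - 1)) / T powr (1 / (\<alpha> - 1))"
    using A \<alpha> by (simp add: powr_add mult_ac)
  also have "A / \<alpha> = kappa \<alpha> / (a powr (1 / \<alpha>) * (1 + (\<alpha> - 1)))"
    by (simp add: A_def)
  finally show ?thesis by (simp add: rho_def Let_def)
qed

section \<open>Choice of \<open>x\<close> and of the constants\<close>

theorem lemma3p2:
  fixes \<alpha> a \<gamma> \<Gamma>\<^sub>1 m :: real
  assumes "\<alpha> > 1" and "a > 0" and "\<gamma> > 0" and "m > 0"
  shows "\<exists>c>0. \<exists>C>0. \<forall>(lam :: nat \<Rightarrow> real) (T :: real) (u :: real \<Rightarrow> complex).
      (\<forall>k\<ge>1. lam k > 0) \<longrightarrow>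
      seq_gap lam = \<gamma> \<longrightarrow>
      seq_dev a \<alpha> lam = ereal \<Gamma>\<^sub>1 \<longrightarrow>
      0 < T \<longrightarrow> T < m \<longrightarrow>
      u absolutely_integrable_on {0<..<T} \<longrightarrow>
      G_transform T u (\<i> * complex_of_real (lam 1)) = 1 \<longrightarrow>
      (\<forall>k\<ge>2. G_transform T u (\<i> * complex_of_real (lam k)) = 0) \<longrightarrow>
      L1_norm T u \<ge> c * T powr C * exp (rho a \<alpha> / T powr (1 / (\<alpha> - 1)))"
proof -
  \<comment> \<open>The absolute value makes \<open>\<Gamma>\<close> nonnegative before any sequence
    is given, so all constants can be fixed in advance.\<close>
  define \<Gamma> where "\<Gamma> = \<bar>\<Gamma>\<^sub>1\<bar>"
  define s where "s = nat \<lceil>(a + 2 * \<Gamma>) / (a * \<alpha>)\<rceil>"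
  define S where "S = real (s + 2)"
  define q where "q = \<alpha> / (\<alpha> - 1)"
  define A where "A = kappa \<alpha> / a powr (1 / \<alpha>)"
  \<comment> \<open>Chosen so that \<open>1 + x / a \<le> D * T powr (- q)\<close> for the optimal
    \<open>x\<close>: the first summand covers the 1, because \<open>T < m\<close>, and the second
    covers \<open>x / a\<close>.\<close>
  define D where "D = m powr q + (2 * A / \<alpha>) powr q / a"
  define K where "K = 4 * \<alpha> * sqrt S + (a + \<Gamma>) * m"
  have s: "a + 2 * \<Gamma> \<le> a * \<alpha> * s"
  proof -
    have "(a + 2 * \<Gamma>) / (a * \<alpha>) \<le> s"
      unfolding s_def by linarith
    then show ?thesis using assms by (simp add: field_simps)
  qed
  have S: "S > 0" by (simp add: S_def)
  have D: "D > 0" using assms by (simp add: D_def add_pos_nonneg)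
  have q: "q > 0" using assms by (simp add: q_def)
  have A: "A \<ge> 0" using assms kappa_nonneg[of \<alpha>] by (simp add: A_def)
  \<comment> \<open>The witnesses are \<open>c = exp (- K) * D powr (- S)\<close> and
    \<open>C = S * q\<close>; the power of \<open>T\<close> stems from the loss
    \<open>S * ln (1 + x / a)\<close>.\<close>
  have "L1_norm T u \<ge> exp (- K) * D powr (- S) * T powr (S * q) * exp (rho a \<alpha> / T powr (1 / (\<alpha> - 1)))"
    if pos: "\<forall>k\<ge>1. lam k > 0" and gap: "seq_gap lam = \<gamma>" and dev: "seq_dev a \<alpha> lam = ereal \<Gamma>\<^sub>1"
      and T: "0 < T" "T < m" and u: "u absolutely_integrable_on {0<..<T}"
      and G1: "G_transform T u (\<i> * complex_of_real (lam 1)) = 1"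
      and G0: "\<forall>k\<ge>2. G_transform T u (\<i> * complex_of_real (lam k)) = 0"
    for lam :: "nat \<Rightarrow> real" and T and u :: "real \<Rightarrow> complex"
  proof -
    \<comment> \<open>The positive gap enters here: it separates the exponents, so the zeros divided
      out are distinct.\<close>
    have inj: "inj_on lam {1..}"
    proof (rule inj_onI, rule ccontr)
      fix k n assume kn: "k \<in> {1..}" "n \<in> {1..}" "lam k = lam n" "k \<noteq> n"
      have "seq_gap lam \<le> \<bar>lam k - lam n\<bar>"
        unfolding seq_gap_def by (rule cInf_lower) (use kn in \<open>auto intro!: bdd_belowI[of _ 0]\<close>)
      then show False using kn gap assms by simp
    qed
    have dev': "\<bar>lam k - a * real k powr \<alpha>\<bar> \<le> \<Gamma> * real k powr (\<alpha> - 1)" if k: "k \<ge> 1" for k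
    proof -
      have "ereal (\<bar>lam k - a * real k powr \<alpha>\<bar> / real k powr (\<alpha> - 1)) \<le> seq_dev a \<alpha> lam"
        unfolding seq_dev_def by (rule SUP_upper) (use k in auto)
      then have "\<bar>lam k - a * real k powr \<alpha>\<bar> / real k powr (\<alpha> - 1) \<le> \<Gamma>"
        by (simp add: dev \<Gamma>_def)
      then show ?thesis using k by (simp add: field_simps)
    qed
    define x where "x = (2 * A / (\<alpha> * T)) powr q"
    have x: "x \<ge> 0" by (simp add: x_def)
    have \<Gamma>: "\<Gamma> \<ge> 0" by (simp add: \<Gamma>_def)
    note bounds = kappa_scaled_le_ln_L1_norm[OF u T(1) x assms(1,2) \<Gamma> s _ inj dev' G1]
    have L: "L1_norm T u > 0"
      using bounds(1) pos G0 by blast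
    have "(x / a) powr (1 / \<alpha>) * kappa \<alpha> \<le> S * ln (1 + x / a) + 4 * \<alpha> * sqrt S
      + T * x / 2 + (a + \<Gamma>) * T + ln (L1_norm T u)"
      unfolding S_def using bounds(2) pos G0 by blast
    moreover have "(a + \<Gamma>) * T \<le> (a + \<Gamma>) * m"
      using T assms \<Gamma> by (intro mult_left_mono) auto
    moreover have "(x / a) powr (1 / \<alpha>) * kappa \<alpha> - T * x / 2 = rho a \<alpha> / T powr (1 / (\<alpha> - 1))"
      using assms T by (intro rho_eq_maximum) (simp_all add: x_def A_def q_def)
    moreover have "S * ln (1 + x / a) \<le> S * (ln D - q * ln T)"
    proof (rule mult_left_mono)
      have "1 \<le> (m / T) powr q"
        using T q by (intro ge_one_powr_ge_zero) auto
      also have "\<dots> = m powr q * T powr (- q)"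
        using T assms by (simp add: powr_divide powr_minus_divide)
      finally have "1 \<le> m powr q * T powr (- q)" .
      moreover have "x / a = (2 * A / \<alpha>) powr q / a * T powr (- q)"
      proof -
        have "2 * A / (\<alpha> * T) = (2 * A / \<alpha>) / T" by simp
        then have "x = (2 * A / \<alpha>) powr q / T powr q"
          using T A assms unfolding x_def by (simp only: powr_divide)
        then show ?thesis by (simp add: powr_minus_divide)
      qed
      ultimately have "1 + x / a \<le> D * T powr (- q)"
        unfolding D_def distrib_right by linarith
      then have "ln (1 + x / a) \<le> ln (D * T powr (- q))"
        using x assms by (intro ln_mono add_pos_nonneg) auto
      also have "\<dots> = ln D - q * ln T"
        using D T by (simp add: ln_mult ln_powr)
      finally show "ln (1 + x / a) \<le> ln D - q * ln T" .
    qed (use S in simp)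
    ultimately have "- K - S * ln D + S * q * ln T + rho a \<alpha> / T powr (1 / (\<alpha> - 1)) \<le> ln (L1_norm T u)"
      unfolding K_def by (simp add: algebra_simps)
    then have "exp (- K - S * ln D + S * q * ln T + rho a \<alpha> / T powr (1 / (\<alpha> - 1))) \<le> L1_norm T u"
      using L by (simp add: ln_ge_iff)
    moreover have "exp (- K - S * ln D + S * q * ln T + rho a \<alpha> / T powr (1 / (\<alpha> - 1)))
        = exp (- K) * D powr (- S) * T powr (S * q) * exp (rho a \<alpha> / T powr (1 / (\<alpha> - 1)))"
      using D T by (simp add: powr_def flip: exp_add)
    ultimately show ?thesis by simp
  qed
  moreover have "exp (- K) * D powr (- S) > 0" "S * q > 0"
    using D S q by simp_all
  ultimately show ?thesis by blast
qed

end
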